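(* For each integer $d\ge 0$, there exist $4^{d+1}$ pairwise disjoint Breaker pairing strategies for $\mathcal{Q}(3^{d+1},3^d+1)$, all of the same cardinality, whose union is the set of all edges of $Q_{3^{d+1}}$.
   Context: $Q_n$ is the hypercube graph on $\{0,1\}^n$ (vertices adjacent iff they differ in exactly one coordinate). A $k$-dimensional subcube of $Q_n$ is obtained by choosing $n-k$ coordinates and fixed values in $\{0,1\}$ for them, and taking all $2^k$ vectors agreeing with these fixed values. $\mathcal{Q}(n,k)$ is the hypergraph with vertex set $\{0,1\}^n$ whose edges are the $k$-dimensional subcubes of $Q_n$ (the Maker–Breaker game is played on it). Following the paper's convention, a Breaker pairing strategy for $\mathcal{Q}(n,k)$ is a matching $M$ in $Q_n$ (a set of pairwise disjoint edges) such that every $k$-dimensional subcube of $Q_n$ contains both endpoints of at least one edge of $M$. *)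

theory Defs
  imports "HOL-Library.FuncSet"
begin

text \<open>
  The vectors in \<open>{0,1}\<^sup>n\<close> are the functions \<open>{..<n} \<rightarrow>\<^sub>E {0, 1}\<close>; coordinates are numbered from 0,
  and extensionality makes each vector a unique HOL function.
\<close>

definition cube_verts :: "nat \<Rightarrow> (nat \<Rightarrow> nat) set" where
  "cube_verts n = {..<n} \<rightarrow>\<^sub>E {0, 1}"

definition cube_adj :: "nat \<Rightarrow> (nat \<Rightarrow> nat) \<Rightarrow> (nat \<Rightarrow> nat) \<Rightarrow> bool" where
  "cube_adj n x y \<longleftrightarrow> x \<in> cube_verts n \<and> y \<in> cube_verts n \<and> (\<exists>!i. i < n \<and> x i \<noteq> y i)"

definition cube_edges :: "nat \<Rightarrow> (nat \<Rightarrow> nat) set set" where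
  "cube_edges n = {{x, y} | x y. cube_adj n x y}"

text \<open>
  Here \<open>F\<close> is the set of the \<open>n - k\<close> fixed coordinates and \<open>a\<close> gives their values. The size
  condition is written additively because subtraction on \<^typ>\<open>nat\<close> truncates, so there are no
  \<open>k\<close>-dimensional subcubes when \<open>k > n\<close>.
\<close>

definition subcubes :: "nat \<Rightarrow> nat \<Rightarrow> (nat \<Rightarrow> nat) set set" where
  "subcubes n k =
     {{x \<in> cube_verts n. \<forall>i\<in>F. x i = a i} | F a.
        F \<subseteq> {..<n} \<and> card F + k = n \<and> a \<in> F \<rightarrow>\<^sub>E {0, 1}}"

definition cube_matching :: "nat \<Rightarrow> (nat \<Rightarrow> nat) set set \<Rightarrow> bool" where
  "cube_matching n M \<longleftrightarrow> M \<subseteq> cube_edges n \<and> pairwise disjnt M"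

text \<open>
  The edges of the hypergraph on which the game is played are the members of
  \<^term>\<open>subcubes n k\<close>.
\<close>

definition breaker_pairing_strategy :: "nat \<Rightarrow> nat \<Rightarrow> (nat \<Rightarrow> nat) set set \<Rightarrow> bool" where
  "breaker_pairing_strategy n k M \<longleftrightarrow>
     cube_matching n M \<and> (\<forall>C \<in> subcubes n k. \<exists>e \<in> M. e \<subseteq> C)"

end

theory Submission
  imports Defs
begin

text \<open>
  Put \<open>D = d + 1\<close> and read a coordinate below \<open>3\<^sup>D\<close> as a word of \<open>D\<close> ternary digits. At every digit
  position \<open>t\<close>, the parities of a vertex over the three digit classes form a vertex of \<open>Q\<^sub>3\<close>, and an
  edge in direction \<open>j\<close> becomes an edge of \<open>Q\<^sub>3\<close> in direction \<open>j\<^sub>t\<close>. The edges of \<open>Q\<^sub>3\<close> split into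
  four pairing strategies, each having one edge per direction; choosing one of them for every \<open>t\<close>
  gives the \<open>4\<^sup>D\<close> strategies.

  For the covering property let \<open>F\<close> be a set of more than \<open>3\<^bsup>D-1\<^esup>\<close> free coordinates, and split it by one
  digit into three slices. If all slices are nonempty, use induction on one that is large enough
  and correct the parities with the other two. Otherwise exactly two are nonempty; the parity of
  the empty one dictates the slice of the direction \<open>j\<close>. If that slice is too small for the induction
  hypothesis, then the other one contains more than two thirds of all words, and such a set
  has subsets of every consistent system of parities.
\<close>

section \<open>Ternary digits, alignment, and splitting by the lowest digit\<close>

definition digit :: "nat \<Rightarrow> nat \<Rightarrow> nat" where
  "digit t i = i div 3 ^ t mod 3"

definition cnt :: "nat set \<Rightarrow> nat \<Rightarrow> nat \<Rightarrow> nat" where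
  "cnt X t a = card {i \<in> X. digit t i = a}"

text \<open>
  Regarding each \<open>P t\<close> as a vertex of \<open>Q\<^sub>3\<close>, this says that \<open>P t\<close> lies on the edge in direction \<open>j\<^sub>t\<close> of
  the pattern \<open>{*10, 0*1, 10*}\<close> (directions 0, 1, 2), which is a pairing strategy for \<open>\<Q>(3, 2)\<close>.
\<close>

definition aligned :: "nat \<Rightarrow> (nat \<Rightarrow> nat \<Rightarrow> bool) \<Rightarrow> nat \<Rightarrow> bool" where
  "aligned D P j \<longleftrightarrow> (\<forall>t<D. P t ((digit t j + 1) mod 3) \<and> \<not> P t ((digit t j + 2) mod 3))"

text \<open>Dividing by 3 the elements with lowest digit \<open>a\<close> drops that digit and moves
  every other digit down one position. \<open>glue\<close> undoes this.\<close>

definition slice :: "nat \<Rightarrow> nat set \<Rightarrow> nat set" where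
  "slice a F = {i. 3 * i + a \<in> F}"

definition glue :: "(nat \<Rightarrow> nat set) \<Rightarrow> nat set" where
  "glue Z = {k. k div 3 \<in> Z (k mod 3)}"

lemma digit_less [simp]: "digit t i < 3"
  by (simp add: digit_def)

lemma digit_0: "digit 0 i = i mod 3"
  by (simp add: digit_def)

lemma digit_Suc: "digit (Suc t) i = digit t (i div 3)"
  by (simp add: digit_def div_mult2_eq)

lemma digits_inj:
  "i < 3 ^ D \<Longrightarrow> j < 3 ^ D \<Longrightarrow> (\<And>t. t < D \<Longrightarrow> digit t i = digit t j) \<Longrightarrow> i = j"
proof (induction D arbitrary: i j)
  case (Suc D)
  have "i div 3 = j div 3"
  proof (rule Suc.IH)
    show "i div 3 < 3 ^ D" "j div 3 < 3 ^ D"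
      using Suc.prems(1,2) by (simp_all add: div_less_iff_less_mult mult.commute)
    show "digit t (i div 3) = digit t (j div 3)" if "t < D" for t
      using Suc.prems(3)[of "Suc t"] that by (simp only: digit_Suc Suc_less_eq)
  qed
  moreover have "i mod 3 = j mod 3"
    using Suc.prems(3)[of 0] by (simp only: digit_0 zero_less_Suc)
  ultimately show ?case
    by (metis div_mult_mod_eq)
qed simp

lemma less_3_cases: "(a::nat) < 3 \<Longrightarrow> a = 0 \<or> a = 1 \<or> a = 2"
  by linarith

lemma sum_less_3: "(\<Sum>r<3. f r) = f 0 + f 1 + f (2::nat)" for f :: "nat \<Rightarrow> nat"
  by (simp add: lessThan_nat_numeral lessThan_Suc numeral_2_eq_2)

lemma sum_rotate:
  fixes f :: "nat \<Rightarrow> nat"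
  assumes "a < 3"
  shows "(\<Sum>r<3. f r) = f a + f ((a + 1) mod 3) + f ((a + 2) mod 3)"
  using less_3_cases[OF assms] by (elim disjE) (simp_all add: sum_less_3 numeral_2_eq_2)

lemma glue_eq: "glue Z = (\<Union>a<3. (\<lambda>i. 3 * i + a) ` Z a)"
proof (intro equalityI subsetI)
  fix k assume "k \<in> glue Z"
  moreover have "k = 3 * (k div 3) + k mod 3" by simp
  ultimately show "k \<in> (\<Union>a<3. (\<lambda>i. 3 * i + a) ` Z a)"
    unfolding glue_def by (intro UN_I[of "k mod 3"] image_eqI[of _ _ "k div 3"]) simp_all
qed (auto simp: glue_def)

lemma card_glue:
  assumes "\<And>a. a < 3 \<Longrightarrow> finite (Z a)"
  shows "card (glue Z) = (\<Sum>a<3. card (Z a))"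
proof -
  have "card (glue Z) = (\<Sum>a<3. card ((\<lambda>i. 3 * i + a) ` Z a))"
    unfolding glue_eq
  proof (rule card_UN_disjoint)
    show "\<forall>i\<in>{..<3::nat}. \<forall>j\<in>{..<3}. i \<noteq> j \<longrightarrow>
        (\<lambda>k. 3 * k + i) ` Z i \<inter> (\<lambda>k. 3 * k + j) ` Z j = {}"
      by (auto simp: disjoint_iff) presburger
  qed (use assms in auto)
  also have "\<dots> = (\<Sum>a<3. card (Z a))"
    by (intro sum.cong refl card_image) (auto simp: inj_on_def)
  finally show ?thesis .
qed

lemma cnt_glue_0:
  assumes "\<And>a. a < 3 \<Longrightarrow> finite (Z a)" and "a < 3"
  shows "cnt (glue Z) 0 a = card (Z a)"
proof -
  have "{k \<in> glue Z. digit 0 k = a} = glue (\<lambda>r. if r = a then Z a else {})"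
    by (auto simp: glue_def digit_0)
  then show ?thesis
    using assms by (simp add: cnt_def card_glue if_distrib[of card] sum.delta cong: if_cong)
qed

lemma cnt_glue_Suc:
  assumes "\<And>a. a < 3 \<Longrightarrow> finite (Z a)"
  shows "cnt (glue Z) (Suc t) r = (\<Sum>a<3. cnt (Z a) t r)"
proof -
  have "{k \<in> glue Z. digit (Suc t) k = r} = glue (\<lambda>a. {i \<in> Z a. digit t i = r})"
    by (auto simp: glue_def digit_Suc)
  then show ?thesis
    using assms by (simp add: cnt_def card_glue)
qed

lemma glue_slice: "glue (\<lambda>a. slice a F) = F"
  by (simp add: glue_def slice_def)

lemma slice_subset: "F \<subseteq> {..<3 ^ Suc D} \<Longrightarrow> slice a F \<subseteq> {..<3 ^ D}"
  by (force simp: slice_def)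

lemma card_slices:
  assumes "F \<subseteq> {..<3 ^ Suc D}"
  shows "card F = (\<Sum>a<3. card (slice a F))"
  using card_glue[of "\<lambda>a. slice a F"] slice_subset[OF assms]
  by (metis finite_lessThan finite_subset glue_slice)

lemma glue_subset: "(\<And>a. a < 3 \<Longrightarrow> Z a \<subseteq> slice a F) \<Longrightarrow> glue Z \<subseteq> F"
  by (auto simp: glue_eq slice_def)

lemma card_le_pow: "A \<subseteq> {..<3 ^ D :: nat} \<Longrightarrow> card A \<le> 3 ^ D"
  using card_mono[of "{..<3 ^ D}" A] by simp

lemma exists_parity:
  assumes "B \<noteq> {}"
  shows "\<exists>Z \<subseteq> B. odd (card Z) = e"
proof -
  obtain b where "b \<in> B" using assms by blast
  then show ?thesis
    by (intro exI[of _ "if e then {b} else {}"]) auto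
qed

text \<open>Indexing the three digit classes cyclically from \<open>a\<close> lets one argument
  serve whichever slice is singled out.\<close>

definition three :: "nat \<Rightarrow> 'a \<Rightarrow> 'a \<Rightarrow> 'a \<Rightarrow> nat \<Rightarrow> 'a" where
  "three a x y z r = (if r = a then x else if r = (a + 1) mod 3 then y else z)"

lemma three_simps [simp]:
  assumes "a < 3"
  shows "three a x y z a = x"
    and "three a x y z ((a + 1) mod 3) = y" "three a x y z (Suc a mod 3) = y"
    and "three a x y z ((a + 2) mod 3) = z" "three a x y z (Suc (Suc a) mod 3) = z"
proof -
  have "(a + 1) mod 3 \<noteq> a" "(a + 2) mod 3 \<noteq> a" "(a + 2) mod 3 \<noteq> (a + 1) mod 3"
    using less_3_cases[OF assms] by (elim disjE; simp)+
  then show "three a x y z a = x"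
    and "three a x y z ((a + 1) mod 3) = y" "three a x y z (Suc a mod 3) = y"
    and "three a x y z ((a + 2) mod 3) = z" "three a x y z (Suc (Suc a) mod 3) = z"
    by (simp_all add: three_def)
qed

lemma all_rotate:
  assumes "(a::nat) < 3"
  shows "(\<forall>r<3. Q r) \<longleftrightarrow> Q a \<and> Q ((a + 1) mod 3) \<and> Q ((a + 2) mod 3)"
proof -
  have "r = a \<or> r = (a + 1) mod 3 \<or> r = (a + 2) mod 3" if "r < 3" for r
    using less_3_cases[OF that] less_3_cases[OF assms] by (elim disjE) simp_all
  moreover have "(a + 1) mod 3 < 3" "(a + 2) mod 3 < 3"
    by simp_all
  ultimately show ?thesis
    using assms by blast
qed

lemma finite_three: "finite A \<Longrightarrow> finite B \<Longrightarrow> finite C \<Longrightarrow> finite (three a A B C r)"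
  by (simp add: three_def)

lemma card_glue_three:
  assumes "a < 3" "finite A" "finite B" "finite C"
  shows "card (glue (three a A B C)) = card A + card B + card C"
  using assms by (simp add: card_glue finite_three sum_rotate[OF assms(1)])

lemma cnt_glue_three_0:
  assumes "a < 3" "finite A" "finite B" "finite C"
  shows "cnt (glue (three a A B C)) 0 a = card A"
    and "cnt (glue (three a A B C)) 0 ((a + 1) mod 3) = card B"
    and "cnt (glue (three a A B C)) 0 ((a + 2) mod 3) = card C"
  using assms by (simp_all add: cnt_glue_0 finite_three)

lemma cnt_glue_three_Suc:
  assumes "a < 3" "finite A" "finite B" "finite C"
  shows "cnt (glue (three a A B C)) (Suc t) r = cnt A t r + cnt B t r + cnt C t r"
  using assms by (simp add: cnt_glue_Suc finite_three sum_rotate[OF assms(1)])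

lemma glue_three_subset:
  assumes "a < 3" "A \<subseteq> slice a F" "B \<subseteq> slice ((a + 1) mod 3) F" "C \<subseteq> slice ((a + 2) mod 3) F"
  shows "glue (three a A B C) \<subseteq> F"
proof (rule glue_subset)
  have "\<forall>r<3. three a A B C r \<subseteq> slice r F"
    unfolding all_rotate[OF assms(1)] using assms by simp
  then show "three a A B C r \<subseteq> slice r F" if "r < 3" for r
    using that by blast
qed

section \<open>Prescribing all digit parities in a dense set\<close>

lemma odd_add3: "odd (x + y + z) \<longleftrightarrow> (odd x \<noteq> odd y) \<noteq> odd (z::nat)"
  by auto

text \<open>Consistency for the recursion: \<open>b\<close> and \<open>c\<close> are the size
  parities of two chosen sets and \<open>b0\<close> to \<open>c2\<close> their class parities. The
  targets left for the third set then sum to its own size parity \<open>a\<close>.\<close>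

lemma xor_balance:
  fixes a b b0 b1 b2 c c0 c1 c2 t0 t1 t2 e :: bool
  assumes "b = ((b0 \<noteq> b1) \<noteq> b2)" "c = ((c0 \<noteq> c1) \<noteq> c2)"
    and "((t0 \<noteq> t1) \<noteq> t2) = e" "((a \<noteq> b) \<noteq> c) = e"
  shows "(((t0 \<noteq> (b0 \<noteq> c0)) \<noteq> (t1 \<noteq> (b1 \<noteq> c1))) \<noteq> (t2 \<noteq> (b2 \<noteq> c2))) = a"
  using assms by argo

lemma card_digits:
  assumes "finite X"
  shows "card X = cnt X t 0 + cnt X t 1 + cnt X t 2"
proof -
  have "X = (\<Union>a<3. {i \<in> X. digit t i = a})" by auto
  then have "card X = card (\<Union>a<3. {i \<in> X. digit t i = a})"
    by (rule arg_cong)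
  also have "\<dots> = (\<Sum>a<3. card {i \<in> X. digit t i = a})"
    using assms by (intro card_UN_disjoint) auto
  finally show ?thesis
    by (simp add: cnt_def sum_less_3)
qed

text \<open>At each position the class counts add up to \<open>card Y\<close>, hence the condition
  on \<open>\<tau>\<close>. Density above 2/3 survives in some slice by averaging and leaves no
  slice empty. The other two slices therefore meet their size parities, and the dense one meets its
  own while correcting the higher digits.\<close>

lemma exists_parities:
  assumes "G \<subseteq> {..<3 ^ D}" and "2 * 3 ^ D < 3 * card G"
    and "\<And>t. t < D \<Longrightarrow> ((\<tau> t 0 \<noteq> \<tau> t 1) \<noteq> \<tau> t 2) = e"
  shows "\<exists>Y \<subseteq> G. odd (card Y) = e \<and> (\<forall>t<D. \<forall>a<3. odd (cnt Y t a) = \<tau> t a)"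
  using assms
proof (induction D arbitrary: G \<tau> e)
  case 0
  then have "G \<noteq> {}" by auto
  from exists_parity[OF this] show ?case by simp
next
  case (Suc D)
  note sub = slice_subset[OF Suc.prems(1)]
  have le: "card (slice r G) \<le> 3 ^ D" for r
    using sub by (rule card_le_pow)
  have sum: "card G = card (slice 0 G) + card (slice 1 G) + card (slice 2 G)"
    using card_slices[OF Suc.prems(1)] by (simp add: sum_less_3)
  have "\<exists>a<3. 2 * 3 ^ D < 3 * card (slice a G)"
  proof (rule ccontr)
    assume "\<not> ?thesis"
    then have "\<forall>a<3. 3 * card (slice a G) \<le> 2 * 3 ^ D" by (meson not_less)
    from this[rule_format, of 0] this[rule_format, of 1] this[rule_format, of 2]
    show False using Suc.prems(2) sum by simp
  qed
  then obtain a where a: "a < 3" "2 * 3 ^ D < 3 * card (slice a G)" by blast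
  let ?b = "(a + 1) mod 3" and ?c = "(a + 2) mod 3"
  \<comment> \<open>Two slices together hold at most \<open>2 * 3 ^ D\<close> elements, fewer than
    \<open>G\<close> has.\<close>
  have ne: "slice r G \<noteq> {}" if "r < 3" for r
  proof
    assume "slice r G = {}"
    with sum less_3_cases[OF that] le[of 0] le[of 1] le[of 2] have "card G \<le> 2 * 3 ^ D"
      by auto
    with Suc.prems(2) show False by simp
  qed
  obtain B where B: "B \<subseteq> slice ?b G" "odd (card B) = \<tau> 0 ?b"
    using exists_parity[OF ne[of ?b]] by auto
  obtain C where C: "C \<subseteq> slice ?c G" "odd (card C) = \<tau> 0 ?c"
    using exists_parity[OF ne[of ?c]] by auto
  have fin: "finite B" "finite C"
    using B C sub by (meson finite_lessThan finite_subset)+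
  \<comment> \<open>What the dense slice must still contribute once \<open>B\<close> and
    \<open>C\<close> are fixed.\<close>
  let ?\<sigma> = "\<lambda>t r. \<tau> (Suc t) r \<noteq> (odd (cnt B t r) \<noteq> odd (cnt C t r))"
  have 0: "((\<tau> 0 a \<noteq> \<tau> 0 ?b) \<noteq> \<tau> 0 ?c) = e"
    using Suc.prems(3)[of 0] less_3_cases[OF a(1)] by (elim disjE) (auto simp: numeral_2_eq_2)
  have "\<exists>Y \<subseteq> slice a G. odd (card Y) = \<tau> 0 a \<and> (\<forall>t<D. \<forall>r<3. odd (cnt Y t r) = ?\<sigma> t r)"
  proof (rule Suc.IH[OF sub a(2)])
    fix t assume "t < D"
    show "((?\<sigma> t 0 \<noteq> ?\<sigma> t 1) \<noteq> ?\<sigma> t 2) = \<tau> 0 a"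
    proof (rule xor_balance[where b = "\<tau> 0 ?b" and c = "\<tau> 0 ?c", OF _ _ _ 0])
      show "\<tau> 0 ?b = ((odd (cnt B t 0) \<noteq> odd (cnt B t 1)) \<noteq> odd (cnt B t 2))"
        unfolding B(2)[symmetric] card_digits[OF fin(1), of t] by (rule odd_add3)
      show "\<tau> 0 ?c = ((odd (cnt C t 0) \<noteq> odd (cnt C t 1)) \<noteq> odd (cnt C t 2))"
        unfolding C(2)[symmetric] card_digits[OF fin(2), of t] by (rule odd_add3)
      show "((\<tau> (Suc t) 0 \<noteq> \<tau> (Suc t) 1) \<noteq> \<tau> (Suc t) 2) = e"
        using Suc.prems(3)[of "Suc t"] \<open>t < D\<close> by simp
    qed
  qed
  then obtain A where A: "A \<subseteq> slice a G" "odd (card A) = \<tau> 0 a"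
      "\<And>t r. t < D \<Longrightarrow> r < 3 \<Longrightarrow> odd (cnt A t r) = ?\<sigma> t r" by blast
  have finA: "finite A"
    using A sub by (meson finite_lessThan finite_subset)
  note fins = a(1) finA fin
  let ?Y = "glue (three a A B C)"
  have "?Y \<subseteq> G"
    using a(1) A(1) B(1) C(1) by (rule glue_three_subset)
  moreover have "odd (card ?Y) = e"
    unfolding card_glue_three[OF fins] odd_add3 A(2) B(2) C(2) by (rule 0)
  moreover have "\<forall>r<3. odd (cnt ?Y 0 r) = \<tau> 0 r"
    unfolding all_rotate[OF a(1)] cnt_glue_three_0[OF fins] using A(2) B(2) C(2) by blast
  moreover have "\<forall>r<3. odd (cnt ?Y (Suc t) r) = \<tau> (Suc t) r" if "t < D" for t
    unfolding cnt_glue_three_Suc[OF fins] odd_add3 using A(3)[OF that] by blast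
  ultimately show ?case
    by (intro exI[of _ ?Y]) (auto simp: less_Suc_eq_0_disj)
qed

section \<open>Aligned directions in sets of more than a third of all words\<close>

lemma digit_glue:
  assumes "a < 3"
  shows "digit 0 (3 * j + a) = a" and "digit (Suc t) (3 * j + a) = digit t j"
  using assms by (simp_all add: digit_0 digit_Suc)

text \<open>The new direction has lowest digit \<open>a\<close>, so alignment at position 0
  constrains only the sizes of \<open>B\<close> and \<open>C\<close>. The size of \<open>A\<close>
  stays free, and \<open>A\<close> can come from an induction hypothesis that says nothing about
  it.\<close>

lemma aligned_glue:
  assumes a: "a < 3" and F: "F \<subseteq> {..<3 ^ Suc D}" and j: "j \<in> slice a F"
    and A: "A \<subseteq> slice a F" and B: "B \<subseteq> slice ((a + 1) mod 3) F"
    and C: "C \<subseteq> slice ((a + 2) mod 3) F"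
    and parB: "odd (card B) = \<tau> 0 ((a + 1) mod 3)"
    and parC: "odd (card C) \<noteq> \<tau> 0 ((a + 2) mod 3)"
    and al: "aligned D (\<lambda>t r. odd (cnt A t r + cnt B t r + cnt C t r) = \<tau> (Suc t) r) j"
  shows "\<exists>j\<in>F. \<exists>Y\<subseteq>F. aligned (Suc D) (\<lambda>t r. odd (cnt Y t r) = \<tau> t r) j"
proof -
  let ?Y = "glue (three a A B C)"
  have fins: "a < 3" "finite A" "finite B" "finite C"
    using a A B C slice_subset[OF F] by (meson finite_lessThan finite_subset)+
  have "?Y \<subseteq> F"
    using a A B C by (rule glue_three_subset)
  moreover have "3 * j + a \<in> F"
    using j by (simp add: slice_def)
  moreover have "aligned (Suc D) (\<lambda>t r. odd (cnt ?Y t r) = \<tau> t r) (3 * j + a)"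
    unfolding aligned_def All_less_Suc2 digit_glue[OF a] cnt_glue_three_0[OF fins]
      cnt_glue_three_Suc[OF fins]
    using parB parC al by (simp add: aligned_def)
  ultimately show ?thesis by blast
qed

text \<open>\<open>A\<close> houses the direction and \<open>B\<close> carries one size constraint.
  If \<open>A\<close> is too small for \<open>IH\<close>, then \<open>B\<close> is dense enough to
  realize all parities by itself, and any direction in \<open>A\<close> works with \<open>Y\<close>
  empty.\<close>

lemma exists_aligned_two:
  assumes A: "A \<subseteq> {..<3 ^ D}" "A \<noteq> {}" and B: "B \<subseteq> {..<3 ^ D}" "B \<noteq> {}"
    and large: "3 ^ D < card A + card B"
    and IH: "\<And>\<tau>. 3 ^ D < 3 * card A \<Longrightarrow>
      \<exists>j\<in>A. \<exists>Y\<subseteq>A. aligned D (\<lambda>t r. odd (cnt Y t r) = \<tau> t r) j"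
  shows "\<exists>j\<in>A. \<exists>Y\<subseteq>A. \<exists>Z\<subseteq>B. odd (card Z) = e \<and>
    aligned D (\<lambda>t r. odd (cnt Y t r + cnt Z t r) = \<tau> t r) j"
proof (cases "3 ^ D < 3 * card A")
  case True
  obtain Z where Z: "Z \<subseteq> B" "odd (card Z) = e"
    using exists_parity[OF B(2)] by auto
  obtain j Y where jY: "j \<in> A" "Y \<subseteq> A"
      "aligned D (\<lambda>t r. odd (cnt Y t r) = (\<tau> t r \<noteq> odd (cnt Z t r))) j"
    using IH[OF True, of "\<lambda>t r. \<tau> t r \<noteq> odd (cnt Z t r)"] by blast
  have "odd (cnt Y t r + cnt Z t r) = \<tau> t r \<longleftrightarrow>
      odd (cnt Y t r) = (\<tau> t r \<noteq> odd (cnt Z t r))" for t r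
    by auto
  with jY(3) have "aligned D (\<lambda>t r. odd (cnt Y t r + cnt Z t r) = \<tau> t r) j"
    by (simp only:)
  with Z jY(1,2) show ?thesis by blast
next
  case False
  then have "2 * 3 ^ D < 3 * card B" using large by simp
  obtain j where j: "j \<in> A" using A(2) by blast
  \<comment> \<open>Alignment dictates the two classes that avoid the digit of \<open>j\<close>. The
    value at the remaining class is chosen to make the total parity \<open>e\<close>.\<close>
  define \<sigma> where "\<sigma> t = three (digit t j) ((e \<noteq> \<tau> t ((digit t j + 1) mod 3)) = \<tau> t ((digit t j + 2) mod 3))
    (\<tau> t ((digit t j + 1) mod 3)) (\<not> \<tau> t ((digit t j + 2) mod 3))" for t
  have "((\<sigma> t 0 \<noteq> \<sigma> t 1) \<noteq> \<sigma> t 2) = e" for t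
    using less_3_cases[OF digit_less[of t j]]
    by (elim disjE) (auto simp: \<sigma>_def three_def numeral_2_eq_2)
  then obtain Z where Z: "Z \<subseteq> B" "odd (card Z) = e"
      "\<And>t r. t < D \<Longrightarrow> r < 3 \<Longrightarrow> odd (cnt Z t r) = \<sigma> t r"
    using exists_parities[OF B(1) \<open>2 * 3 ^ D < 3 * card B\<close>, of \<sigma> e] by blast
  have "aligned D (\<lambda>t r. odd (cnt {} t r + cnt Z t r) = \<tau> t r) j"
    unfolding aligned_def using Z(3) by (simp add: \<sigma>_def cnt_def)
  with Z(1,2) j show ?thesis by blast
qed

text \<open>In the covering argument \<open>F\<close> holds the free coordinates of a subcube,
  \<open>j\<close> is the direction of the edge and \<open>Y\<close> the set of free coordinates set
  to one; \<open>\<tau>\<close> absorbs the label and the fixed coordinates. For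
  \<open>D = 0\<close> the threshold just says that \<open>F\<close> is nonempty.\<close>

lemma exists_aligned:
  assumes "F \<subseteq> {..<3 ^ D}" and "3 ^ D < 3 * card F"
  shows "\<exists>j\<in>F. \<exists>Y\<subseteq>F. aligned D (\<lambda>t r. odd (cnt Y t r) = \<tau> t r) j"
  using assms
proof (induction D arbitrary: F \<tau>)
  case 0
  then have "F \<noteq> {}" by auto
  then show ?case by (auto simp: aligned_def)
next
  case (Suc D)
  note F = Suc.prems(1)
  note sub = slice_subset[OF F]
  have le: "card (slice r F) \<le> 3 ^ D" for r
    using sub by (rule card_le_pow)
  have sum: "3 ^ D < card (slice a F) + card (slice ((a + 1) mod 3) F) + card (slice ((a + 2) mod 3) F)"
    if "a < 3" for a
    using card_slices[OF F] Suc.prems(2) sum_rotate[OF that, of "\<lambda>r. card (slice r F)"] by simp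
  show ?case
  proof (cases "\<exists>m<3. slice m F = {}")
    case False
    then have ne: "slice r F \<noteq> {}" if "r < 3" for r using that by blast
    obtain a where a: "a < 3" "3 ^ D < 3 * card (slice a F)"
    proof (rule ccontr)
      assume "\<not> thesis"
      with that have "\<not> 3 ^ D < 3 * card (slice a F)" if "a < 3" for a using that by blast
      from this[of 0] this[of 1] this[of 2] show False
        using sum[of 0] by (simp add: numeral_2_eq_2)
    qed
    obtain B where B: "B \<subseteq> slice ((a + 1) mod 3) F" "odd (card B) = \<tau> 0 ((a + 1) mod 3)"
      using exists_parity[OF ne[of "(a + 1) mod 3"]] by auto
    obtain C where C: "C \<subseteq> slice ((a + 2) mod 3) F" "odd (card C) = (\<not> \<tau> 0 ((a + 2) mod 3))"
      using exists_parity[OF ne[of "(a + 2) mod 3"]] by auto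
    obtain j A where A: "j \<in> slice a F" "A \<subseteq> slice a F" "aligned D (\<lambda>t r. odd (cnt A t r) =
        (\<tau> (Suc t) r \<noteq> odd (cnt B t r + cnt C t r))) j"
      using Suc.IH[OF sub a(2), of "\<lambda>t r. \<tau> (Suc t) r \<noteq> odd (cnt B t r + cnt C t r)"] by blast
    have "odd (cnt A t r + cnt B t r + cnt C t r) = \<tau> (Suc t) r \<longleftrightarrow>
        odd (cnt A t r) = (\<tau> (Suc t) r \<noteq> odd (cnt B t r + cnt C t r))" for t r
      by auto
    with A(3) have "aligned D (\<lambda>t r. odd (cnt A t r + cnt B t r + cnt C t r) = \<tau> (Suc t) r) j"
      by simp
    with C(2) show ?thesis
      by (intro aligned_glue[where \<tau> = \<tau>, OF a(1) F A(1,2) B(1) C(1) B(2)]) auto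
  next
    case True
    then obtain m where m: "m < 3" "slice m F = {}" by blast
    define p q where "p = (m + 1) mod 3" and "q = (m + 2) mod 3"
    have pq: "p < 3" "q < 3" by (simp_all add: p_def q_def)
    have rot: "(p + 1) mod 3 = q" "(p + 2) mod 3 = m" "(q + 1) mod 3 = m" "(q + 2) mod 3 = p"
      unfolding p_def q_def using less_3_cases[OF m(1)] by (elim disjE; simp)+
    have large: "3 ^ D < card (slice p F) + card (slice q F)"
      using sum[OF m(1)] m(2) by (simp add: p_def q_def)
    have ne: "slice p F \<noteq> {}" "slice q F \<noteq> {}"
      using large le[of p] le[of q] by auto
    have cnt_empty: "cnt {} t r = 0" for t r by (simp add: cnt_def)
    \<comment> \<open>The empty slice has an even count. If \<open>\<tau> 0 m\<close> holds, this is
      a mismatch, so \<open>m\<close> must come second after the class of the direction, which is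
      then \<open>p\<close>. Otherwise it is a match, \<open>m\<close> comes first, and the class is
      \<open>q\<close>.\<close>
    show ?thesis
    proof (cases "\<tau> 0 m")
      case True
      obtain j Y Z where "j \<in> slice p F" "Y \<subseteq> slice p F" "Z \<subseteq> slice q F" "odd (card Z) = \<tau> 0 q"
          "aligned D (\<lambda>t r. odd (cnt Y t r + cnt Z t r) = \<tau> (Suc t) r) j"
        using exists_aligned_two[OF sub ne(1) sub ne(2) large Suc.IH[OF sub], of "\<tau> 0 q" "\<lambda>t. \<tau> (Suc t)"]
        by blast
      with True show ?thesis
        by (intro aligned_glue[where C = "{}", OF pq(1) F]) (auto simp: rot[simplified] cnt_empty)
    next
      case False
      obtain j Y Z where "j \<in> slice q F" "Y \<subseteq> slice q F" "Z \<subseteq> slice p F" "odd (card Z) = (\<not> \<tau> 0 p)"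
          "aligned D (\<lambda>t r. odd (cnt Y t r + cnt Z t r) = \<tau> (Suc t) r) j"
        using exists_aligned_two[OF sub ne(2) sub ne(1) _ Suc.IH[OF sub], of "\<not> \<tau> 0 p" "\<lambda>t. \<tau> (Suc t)"] large
        by (auto simp: add.commute)
      with False show ?thesis
        by (intro aligned_glue[where B = "{}", OF pq(2) F]) (auto simp: rot[simplified] cnt_empty)
    qed
  qed
qed

section \<open>Vertices and edges of the cube as sets of coordinates\<close>

definition vert :: "nat \<Rightarrow> nat set \<Rightarrow> nat \<Rightarrow> nat" where
  "vert n X = (\<lambda>i\<in>{..<n}. of_bool (i \<in> X))"

text \<open>An edge is recorded by an endpoint and a direction, so it has two descriptions, from
  \<open>X\<close> and from \<open>sym_diff X {j}\<close>.\<close>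

definition edge :: "nat \<Rightarrow> nat set \<Rightarrow> nat \<Rightarrow> (nat \<Rightarrow> nat) set" where
  "edge n X j = {vert n X, vert n (sym_diff X {j})}"

lemma vert_eq_iff:
  assumes "X \<subseteq> {..<n}" "Y \<subseteq> {..<n}"
  shows "vert n X = vert n Y \<longleftrightarrow> X = Y"
proof
  assume eq: "vert n X = vert n Y"
  have "i \<in> X \<longleftrightarrow> i \<in> Y" if "i < n" for i
    using fun_cong[OF eq, of i] that by (simp add: vert_def of_bool_def split: if_splits)
  with assms show "X = Y" by blast
qed simp

lemma vert_support:
  assumes "x \<in> cube_verts n"
  shows "vert n {i. i < n \<and> x i = 1} = x"
proof
  fix i
  show "vert n {i. i < n \<and> x i = 1} i = x i"
    using assms by (cases "i < n") (auto simp: vert_def cube_verts_def PiE_def Pi_def extensional_def)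
qed

lemma vert_in_cube_verts: "vert n X \<in> cube_verts n"
  by (auto simp: vert_def cube_verts_def)

lemma cube_verts_eq: "cube_verts n = vert n ` Pow {..<n}"
proof (intro equalityI subsetI)
  fix x assume "x \<in> cube_verts n"
  then show "x \<in> vert n ` Pow {..<n}"
    by (intro image_eqI[of _ _ "{i. i < n \<and> x i = 1}"] vert_support[symmetric]) auto
qed (auto simp: vert_in_cube_verts)

lemma sym_diff_flip_subset: "X \<subseteq> {..<n} \<Longrightarrow> j < n \<Longrightarrow> sym_diff X {j} \<subseteq> {..<n}"
  by auto

lemma ex1_mem_iff: "(\<exists>!i. i \<in> S) \<longleftrightarrow> (\<exists>j. S = {j})"
  by auto

lemma cube_adj_vert:
  assumes "X \<subseteq> {..<n}" "Y \<subseteq> {..<n}"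
  shows "cube_adj n (vert n X) (vert n Y) \<longleftrightarrow> (\<exists>j<n. Y = sym_diff X {j})"
proof -
  have "(i < n \<and> vert n X i \<noteq> vert n Y i) \<longleftrightarrow> i \<in> sym_diff X Y" for i
    using assms by (auto simp: vert_def)
  then have "cube_adj n (vert n X) (vert n Y) \<longleftrightarrow> (\<exists>!i. i \<in> sym_diff X Y)"
    by (simp only: cube_adj_def vert_in_cube_verts simp_thms)
  also have "\<dots> \<longleftrightarrow> (\<exists>j. sym_diff X Y = {j})"
    by (rule ex1_mem_iff)
  also have "\<dots> \<longleftrightarrow> (\<exists>j. Y = sym_diff X {j})"
    unfolding set_eq_iff by (intro iff_exI iff_allI) auto
  also have "\<dots> \<longleftrightarrow> (\<exists>j<n. Y = sym_diff X {j})"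
  proof (intro iff_exI iffI conjI)
    fix j assume "Y = sym_diff X {j}"
    then have "j \<in> X \<or> j \<in> Y" by auto
    with assms show "j < n" by auto
  qed auto
  finally show ?thesis .
qed

lemma cube_edges_eq: "cube_edges n = {edge n X j | X j. X \<subseteq> {..<n} \<and> j < n}"
proof (intro equalityI subsetI)
  fix e assume "e \<in> cube_edges n"
  then obtain x y where e: "e = {x, y}" "cube_adj n x y"
    by (auto simp: cube_edges_def)
  then have "x \<in> vert n ` Pow {..<n}" "y \<in> vert n ` Pow {..<n}"
    by (simp_all add: cube_adj_def flip: cube_verts_eq)
  then obtain X Y where XY: "X \<subseteq> {..<n}" "Y \<subseteq> {..<n}" "x = vert n X" "y = vert n Y"
    by blast
  with e cube_adj_vert obtain j where "j < n" "Y = sym_diff X {j}" by blast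
  with e(1) XY show "e \<in> {edge n X j | X j. X \<subseteq> {..<n} \<and> j < n}"
    unfolding edge_def by blast
next
  fix e assume "e \<in> {edge n X j | X j. X \<subseteq> {..<n} \<and> j < n}"
  then obtain X j where e: "e = edge n X j" "X \<subseteq> {..<n}" "j < n" by blast
  then have "cube_adj n (vert n X) (vert n (sym_diff X {j}))"
    using cube_adj_vert[OF e(2) sym_diff_flip_subset[OF e(2,3)]] by blast
  with e(1) show "e \<in> cube_edges n"
    unfolding cube_edges_def edge_def by blast
qed

section \<open>Parities under symmetric difference and uniqueness of the direction\<close>

lemma odd_cnt_sym_diff:
  assumes "finite X" "finite Y"
  shows "odd (cnt (sym_diff X Y) t r) \<longleftrightarrow> odd (cnt X t r) \<noteq> odd (cnt Y t r)"
proof -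
  let ?A = "{i \<in> X. digit t i = r}" and ?B = "{i \<in> Y. digit t i = r}"
  have "{i \<in> sym_diff X Y. digit t i = r} = (?A - ?B) \<union> (?B - ?A)" by blast
  then have "cnt (sym_diff X Y) t r = card (?A - ?B) + card (?B - ?A)"
    unfolding cnt_def using assms by (simp only:) (intro card_Un_disjoint; auto)
  moreover have "cnt X t r = card (?A - ?B) + card (?A \<inter> ?B)"
    unfolding cnt_def using assms by (subst card_Un_disjoint[symmetric]) (auto intro!: arg_cong[of _ _ card])
  moreover have "cnt Y t r = card (?B - ?A) + card (?A \<inter> ?B)"
    unfolding cnt_def using assms by (subst card_Un_disjoint[symmetric]) (auto intro!: arg_cong[of _ _ card])
  ultimately show ?thesis by (simp only: odd_add) blast
qed

text \<open>Of two different digits at position \<open>t\<close>, one is the cyclic successor of the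
  other. If they are \<open>a\<close> and \<open>a + 1\<close> modulo 3, the first needs
  \<open>P t\<close> to fail at \<open>a + 2\<close> and the second needs it to hold there.\<close>

lemma aligned_unique:
  assumes "aligned D P i" "aligned D P j" "i < 3 ^ D" "j < 3 ^ D"
  shows "i = j"
proof (rule digits_inj[OF assms(3,4)])
  fix t assume "t < D"
  then have "P t ((digit t i + 1) mod 3)" "\<not> P t ((digit t i + 2) mod 3)"
    "P t ((digit t j + 1) mod 3)" "\<not> P t ((digit t j + 2) mod 3)"
    using assms(1,2) by (auto simp: aligned_def)
  then show "digit t i = digit t j"
    using less_3_cases[OF digit_less[of t i]] less_3_cases[OF digit_less[of t j]]
    by (elim disjE) (auto simp: numeral_2_eq_2)
qed

text \<open>Alignment never inspects the class containing \<open>j\<close>, the only one whose count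
  changes when \<open>j\<close> is flipped.\<close>

lemma aligned_cong:
  assumes "\<And>t r. t < D \<Longrightarrow> r < 3 \<Longrightarrow> r \<noteq> digit t j \<Longrightarrow> P t r = Q t r"
  shows "aligned D P j = aligned D Q j"
proof -
  have "(a + 1) mod 3 \<noteq> a" "(a + 2) mod 3 \<noteq> a" if "a < 3" for a :: nat
    using less_3_cases[OF that] by (elim disjE; simp)+
  with assms show ?thesis by (simp add: aligned_def)
qed

section \<open>The strategies are matchings and cover the subcubes\<close>

text \<open>At position \<open>t\<close> the label selects a translate of the pattern of
  \<open>aligned\<close>; since parities are compared for equality with membership, the translation
  vector is the complement of \<open>\<gamma> t\<close>.\<close>

definition fits :: "nat \<Rightarrow> (nat \<Rightarrow> nat set) \<Rightarrow> nat set \<Rightarrow> nat \<Rightarrow> bool" where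
  "fits D \<gamma> X j \<longleftrightarrow> aligned D (\<lambda>t r. odd (cnt X t r) = (r \<in> \<gamma> t)) j"

definition strategy :: "nat \<Rightarrow> (nat \<Rightarrow> nat set) \<Rightarrow> (nat \<Rightarrow> nat) set set" where
  "strategy D \<gamma> = {edge (3 ^ D) X j | X j. X \<subseteq> {..<3 ^ D} \<and> j < 3 ^ D \<and> fits D \<gamma> X j}"

text \<open>This makes membership in a strategy independent of the endpoint from which the edge is
  described.\<close>

lemma fits_flip:
  assumes "finite X"
  shows "fits D \<gamma> (sym_diff X {j}) j \<longleftrightarrow> fits D \<gamma> X j"
  unfolding fits_def
proof (rule aligned_cong)
  fix t r assume "r \<noteq> digit t j"
  then have "cnt {j} t r = 0" by (auto simp: cnt_def)
  then show "(odd (cnt (sym_diff X {j}) t r) = (r \<in> \<gamma> t)) = (odd (cnt X t r) = (r \<in> \<gamma> t))"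
    using odd_cnt_sym_diff[OF assms, of "{j}" t r] by auto
qed

lemma edge_flip: "edge n (sym_diff X {j}) j = edge n X j"
proof -
  have "sym_diff (sym_diff X {j}) {j} = X" by blast
  then show ?thesis by (auto simp: edge_def)
qed

lemma vert_in_edge_iff:
  assumes "X \<subseteq> {..<n}" "j < n" "V \<subseteq> {..<n}"
  shows "vert n V \<in> edge n X j \<longleftrightarrow> V = X \<or> V = sym_diff X {j}"
  using vert_eq_iff[OF assms(3,1)] vert_eq_iff[OF assms(3) sym_diff_flip_subset[OF assms(1,2)]]
  by (simp add: edge_def)

text \<open>Edges through a common vertex can all be described from it and then compared by
  direction alone.\<close>

lemma strategy_at_vertex:
  assumes "e \<in> strategy D \<gamma>" "vert (3 ^ D) V \<in> e" "V \<subseteq> {..<3 ^ D}"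
  obtains j where "j < 3 ^ D" "e = edge (3 ^ D) V j" "fits D \<gamma> V j"
proof -
  obtain X j where e: "e = edge (3 ^ D) X j" "X \<subseteq> {..<3 ^ D}" "j < 3 ^ D" "fits D \<gamma> X j"
    using assms(1) unfolding strategy_def by blast
  have "finite X" using e(2) by (rule finite_subset) simp
  have "V = X \<or> V = sym_diff X {j}"
    using assms(2,3) vert_in_edge_iff[OF e(2,3)] e(1) by blast
  then have "e = edge (3 ^ D) V j" "fits D \<gamma> V j"
    by (elim disjE; simp only: e edge_flip fits_flip[OF \<open>finite X\<close>])+
  with e(3) show thesis by (rule that)
qed

lemma edge_inj:
  assumes "edge n V i = edge n V j" "V \<subseteq> {..<n}" "i < n" "j < n"
  shows "i = j"
proof -
  have "vert n (sym_diff V {i}) \<in> edge n V j"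
    using assms(1) by (auto simp: edge_def)
  then have "sym_diff V {i} = V \<or> sym_diff V {i} = sym_diff V {j}"
    by (simp only: vert_in_edge_iff[OF assms(2,4) sym_diff_flip_subset[OF assms(2,3)]])
  moreover have "i \<in> sym_diff V {i} \<longleftrightarrow> i \<notin> V" by simp
  moreover have "i \<in> sym_diff V {j} \<longleftrightarrow> i \<in> V" if "i \<noteq> j" using that by simp
  ultimately show ?thesis by metis
qed

lemma strategy_subset: "strategy D \<gamma> \<subseteq> cube_edges (3 ^ D)"
  unfolding strategy_def cube_edges_eq by blast

lemma edge_vertexE:
  assumes "e \<in> cube_edges n" "v \<in> e"
  obtains V where "V \<subseteq> {..<n}" "v = vert n V"
proof -
  have "v \<in> cube_verts n"
    using assms by (auto simp: cube_edges_def cube_adj_def)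
  with that show thesis by (auto simp: cube_verts_eq)
qed

lemma cube_matching_strategy: "cube_matching (3 ^ D) (strategy D \<gamma>)"
  unfolding cube_matching_def pairwise_def
proof (intro conjI strategy_subset ballI impI)
  fix e f assume ef: "e \<in> strategy D \<gamma>" "f \<in> strategy D \<gamma>" "e \<noteq> f"
  show "disjnt e f"
  proof (rule ccontr)
    assume "\<not> disjnt e f"
    then obtain v where v: "v \<in> e" "v \<in> f" by (auto simp: disjnt_def)
    obtain V where V: "V \<subseteq> {..<3 ^ D}" "v = vert (3 ^ D) V"
      using edge_vertexE[OF subsetD[OF strategy_subset ef(1)] v(1)] by metis
    obtain i where i: "i < 3 ^ D" "e = edge (3 ^ D) V i" "fits D \<gamma> V i"
      using strategy_at_vertex[OF ef(1) v(1)[unfolded V(2)] V(1)] by metis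
    obtain j where j: "j < 3 ^ D" "f = edge (3 ^ D) V j" "fits D \<gamma> V j"
      using strategy_at_vertex[OF ef(2) v(2)[unfolded V(2)] V(1)] by metis
    have "i = j"
      using i(3) j(3) i(1) j(1) unfolding fits_def by (rule aligned_unique)
    with i j ef(3) show False by simp
  qed
qed

lemma strategy_covers_subcube:
  assumes "C \<in> subcubes (3 ^ D) k" "3 ^ D < 3 * k"
  shows "\<exists>e \<in> strategy D \<gamma>. e \<subseteq> C"
proof -
  obtain F a where C: "C = {x \<in> cube_verts (3 ^ D). \<forall>i\<in>F. x i = a i}"
    and F: "F \<subseteq> {..<3 ^ D}" "card F + k = 3 ^ D" and a: "a \<in> F \<rightarrow>\<^sub>E {0, 1}"
    using assms(1) unfolding subcubes_def by blast
  define E where "E = {..<3 ^ D} - F"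
  have "finite F" using F(1) by (rule finite_subset) simp
  then have "card E = k" using F by (simp add: E_def card_Diff_subset)
  \<comment> \<open>The coordinates fixed to one lie in both endpoints of the edge sought and shift
    the target parities.\<close>
  define B where "B = {i \<in> F. a i = 1}"
  have E: "E \<subseteq> {..<3 ^ D}" by (auto simp: E_def)
  obtain j Y where jY: "j \<in> E" "Y \<subseteq> E"
      "aligned D (\<lambda>t r. odd (cnt Y t r) = ((r \<in> \<gamma> t) \<noteq> odd (cnt B t r))) j"
    using exists_aligned[OF E, of "\<lambda>t r. (r \<in> \<gamma> t) \<noteq> odd (cnt B t r)"] assms(2) \<open>card E = k\<close>
    by auto
  \<comment> \<open>\<open>Y\<close> and \<open>B\<close> are disjoint, so this is their union,
    written in the form for which parities add.\<close>
  define X where "X = sym_diff Y B"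
  have j: "j < 3 ^ D" "j \<notin> F" and "Y \<inter> F = {}" "Y \<subseteq> {..<3 ^ D}"
    using jY(1,2) by (auto simp: E_def)
  moreover have "B \<subseteq> F" by (auto simp: B_def)
  ultimately have X: "X \<subseteq> {..<3 ^ D}" "X \<inter> F = B" "sym_diff X {j} \<inter> F = B"
    using F(1) unfolding X_def by blast+
  have fin: "finite Y" "finite B"
    using \<open>Y \<subseteq> {..<3 ^ D}\<close> \<open>B \<subseteq> F\<close> \<open>finite F\<close> by (simp_all add: finite_subset)
  have "fits D \<gamma> X j"
    unfolding fits_def
  proof (rule aligned_cong[THEN iffD1, OF _ jY(3)])
    show "(odd (cnt Y t r) = ((r \<in> \<gamma> t) \<noteq> odd (cnt B t r))) =
        (odd (cnt X t r) = (r \<in> \<gamma> t))" for t r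
      unfolding X_def odd_cnt_sym_diff[OF fin] by blast
  qed
  then have "edge (3 ^ D) X j \<in> strategy D \<gamma>"
    using X(1) j(1) unfolding strategy_def by blast
  moreover have in_C: "vert (3 ^ D) V \<in> C" if "V \<inter> F = B" for V
  proof -
    have "vert (3 ^ D) V i = a i" if "i \<in> F" for i
    proof -
      have "i < 3 ^ D" "i \<in> V \<longleftrightarrow> a i = 1" "a i \<in> {0, 1}"
        using that F(1) a \<open>V \<inter> F = B\<close> by (auto simp: B_def)
      then show ?thesis by (auto simp: vert_def)
    qed
    then show ?thesis by (simp add: C vert_in_cube_verts)
  qed
  have "edge (3 ^ D) X j \<subseteq> C"
    unfolding edge_def using in_C[OF X(2)] in_C[OF X(3)] by simp
  ultimately show ?thesis by blast
qed

section \<open>Labels and the partition of the edge set\<close>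

text \<open>
  Even translates suffice and are needed: the four translates of the pattern of
  \<^const>\<open>aligned\<close> by even vectors partition the edges of \<open>Q\<^sub>3\<close>, whereas translating by
  all eight vectors would use every edge twice.
\<close>

definition even_sets :: "nat set set" where
  "even_sets = {{}, {0, 1}, {0, 2}, {1, 2}}"

definition labels :: "nat \<Rightarrow> (nat \<Rightarrow> nat set) set" where
  "labels D = {..<D} \<rightarrow>\<^sub>E even_sets"

lemma even_sets_parity: "g \<in> even_sets \<Longrightarrow> ((0 \<in> g) \<noteq> (1 \<in> g)) = (2 \<in> g)"
  unfolding even_sets_def by (elim insertE emptyE; simp)

lemma ex1_even_set_at_two:
  assumes "x \<noteq> y" "x \<noteq> z" "y \<noteq> z"
  shows "\<exists>!g. g \<in> {{}, {x, y}, {x, z}, {y, z}} \<and> (x \<in> g) = p \<and> (y \<in> g) = q"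
proof (rule ex1I)
  let ?h = "if p then if q then {x, y} else {x, z} else if q then {y, z} else {}"
  show "?h \<in> {{}, {x, y}, {x, z}, {y, z}} \<and> (x \<in> ?h) = p \<and> (y \<in> ?h) = q"
    using assms by simp
  show "g = ?h" if "g \<in> {{}, {x, y}, {x, z}, {y, z}} \<and> (x \<in> g) = p \<and> (y \<in> g) = q" for g
  proof -
    have "g = {} \<or> g = {x, y} \<or> g = {x, z} \<or> g = {y, z}" "p = (x \<in> g)" "q = (y \<in> g)"
      using that by simp_all
    then show ?thesis using assms by (elim disjE; simp)
  qed
qed

text \<open>Two memberships can be prescribed at will, and evenness decides the third.\<close>

lemma even_sets_ex1:
  assumes "a < 3"
  shows "\<exists>!g. g \<in> even_sets \<and> ((a + 1) mod 3 \<in> g) = p \<and> ((a + 2) mod 3 \<in> g) = q"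
proof -
  let ?b = "(a + 1) mod 3" and ?c = "(a + 2) mod 3"
  have "even_sets = {{}, {?b, ?c}, {?b, a}, {?c, a}}"
    using less_3_cases[OF assms]
    by (elim disjE; simp add: even_sets_def) (simp_all add: insert_commute numeral_2_eq_2)
  moreover have "?b \<noteq> ?c" "?b \<noteq> a" "?c \<noteq> a"
    using less_3_cases[OF assms] by (elim disjE; simp)+
  ultimately show ?thesis
    using ex1_even_set_at_two[of ?b ?c a p q] by (simp only: not_False_eq_True)
qed

lemma card_labels: "card (labels D) = 4 ^ D"
proof -
  have "card even_sets = 4"
    by (simp add: even_sets_def card_insert_if doubleton_eq_iff)
  then show ?thesis by (simp add: labels_def card_PiE)
qed

lemma fits_iff:
  "fits D \<gamma> X j \<longleftrightarrow> (\<forall>t<D.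
     ((digit t j + 1) mod 3 \<in> \<gamma> t) = odd (cnt X t ((digit t j + 1) mod 3)) \<and>
     ((digit t j + 2) mod 3 \<in> \<gamma> t) = even (cnt X t ((digit t j + 2) mod 3)))"
  by (auto simp: fits_def aligned_def)

text \<open>Positions are independent, and at each one alignment prescribes exactly two memberships
  of \<open>\<gamma> t\<close>. Existence gives the full union, uniqueness the disjointness.\<close>

lemma fits_ex1: "\<exists>!\<gamma>. \<gamma> \<in> labels D \<and> fits D \<gamma> X j"
proof -
  let ?Q = "\<lambda>t g. ((digit t j + 1) mod 3 \<in> g) = odd (cnt X t ((digit t j + 1) mod 3)) \<and>
     ((digit t j + 2) mod 3 \<in> g) = even (cnt X t ((digit t j + 2) mod 3))"
  have ex1: "\<exists>!g. g \<in> even_sets \<and> ?Q t g" for t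
    by (rule even_sets_ex1) simp
  then obtain \<gamma> where \<gamma>: "\<And>t. \<gamma> t \<in> even_sets \<and> ?Q t (\<gamma> t)" by metis
  show ?thesis
  proof (rule ex1I[of _ "restrict \<gamma> {..<D}"])
    show "restrict \<gamma> {..<D} \<in> labels D \<and> fits D (restrict \<gamma> {..<D}) X j"
      using \<gamma> by (simp add: labels_def fits_iff)
  next
    fix \<beta> assume \<beta>: "\<beta> \<in> labels D \<and> fits D \<beta> X j"
    show "\<beta> = restrict \<gamma> {..<D}"
    proof
      fix t
      show "\<beta> t = restrict \<gamma> {..<D} t"
      proof (cases "t < D")
        case True
        with \<beta> have "\<beta> t \<in> even_sets \<and> ?Q t (\<beta> t)"
          by (auto simp only: labels_def fits_iff PiE_mem lessThan_iff)
        then have "\<beta> t = \<gamma> t" using ex1[of t] \<gamma>[of t] by blast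
        with True show ?thesis by simp
      next
        case False
        with \<beta> show ?thesis by (simp add: labels_def PiE_def extensional_def)
      qed
    qed
  qed
qed

lemma disjnt_strategies:
  assumes "\<gamma> \<in> labels D" "\<delta> \<in> labels D" "\<gamma> \<noteq> \<delta>"
  shows "disjnt (strategy D \<gamma>) (strategy D \<delta>)"
proof (rule ccontr)
  assume "\<not> ?thesis"
  then obtain e where e: "e \<in> strategy D \<gamma>" "e \<in> strategy D \<delta>" by (auto simp: disjnt_def)
  obtain X i where X: "e = edge (3 ^ D) X i" "X \<subseteq> {..<3 ^ D}" "i < 3 ^ D" "fits D \<gamma> X i"
    using e(1) unfolding strategy_def by blast
  have "vert (3 ^ D) X \<in> e" by (simp add: X(1) edge_def)
  then obtain j where j: "j < 3 ^ D" "e = edge (3 ^ D) X j" "fits D \<delta> X j"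
    using strategy_at_vertex[OF e(2) _ X(2)] by blast
  have "i = j"
    using edge_inj[OF _ X(2,3) j(1)] X(1) j(2) by blast
  with X(4) j(3) assms fits_ex1 show False by blast
qed

lemma Union_strategies: "(\<Union>\<gamma>\<in>labels D. strategy D \<gamma>) = cube_edges (3 ^ D)"
proof
  show "cube_edges (3 ^ D) \<subseteq> (\<Union>\<gamma>\<in>labels D. strategy D \<gamma>)"
  proof
    fix e assume "e \<in> cube_edges (3 ^ D)"
    then obtain X j where "e = edge (3 ^ D) X j" "X \<subseteq> {..<3 ^ D}" "j < 3 ^ D"
      unfolding cube_edges_eq by blast
    moreover obtain \<gamma> where "\<gamma> \<in> labels D" "fits D \<gamma> X j" using fits_ex1 by blast
    ultimately show "e \<in> (\<Union>\<gamma>\<in>labels D. strategy D \<gamma>)"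
      unfolding strategy_def by blast
  qed
qed (use strategy_subset in blast)

section \<open>Equal cardinalities\<close>

lemma finite_strategy: "finite (strategy D \<gamma>)"
proof -
  have "strategy D \<gamma> \<subseteq> (\<lambda>(X, j). edge (3 ^ D) X j) ` (Pow {..<3 ^ D} \<times> {..<3 ^ D})"
    by (auto simp: strategy_def)
  then show ?thesis by (rule finite_subset) simp
qed

text \<open>A translation of the cube carries edges of the first strategy onto all edges of the
  second. Exchanging the labels gives equality.\<close>

lemma card_strategy_le:
  assumes "\<gamma> \<in> labels D" "\<delta> \<in> labels D"
  shows "card (strategy D \<delta>) \<le> card (strategy D \<gamma>)"
proof -
  let ?n = "3 ^ D :: nat"
  let ?\<tau> = "\<lambda>t r. (r \<in> \<gamma> t) \<noteq> (r \<in> \<delta> t)"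
  have "((?\<tau> t 0 \<noteq> ?\<tau> t 1) \<noteq> ?\<tau> t 2) = False" if "t < D" for t
  proof -
    have "\<gamma> t \<in> even_sets" "\<delta> t \<in> even_sets"
      using assms that by (auto simp: labels_def)
    from this[THEN even_sets_parity] show ?thesis by blast
  qed
  \<comment> \<open>Both labels are even, so their difference is consistent with total parity
    \<open>False\<close>, and the set of all words is dense enough.\<close>
  then obtain Z where Z: "Z \<subseteq> {..<?n}"
      "\<And>t r. t < D \<Longrightarrow> r < 3 \<Longrightarrow> odd (cnt Z t r) = ?\<tau> t r"
    using exists_parities[of "{..<?n}" D ?\<tau> False] by auto
  have finZ: "finite Z" using Z(1) by (rule finite_subset) simp
  \<comment> \<open>Translation by \<open>Z\<close>, acting on a vertex through its support.\<close>
  define \<phi> where "\<phi> x = vert ?n (sym_diff {i. i < ?n \<and> x i = 1} Z)" for x :: "nat \<Rightarrow> nat"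
  have \<phi>: "\<phi> (vert ?n X) = vert ?n (sym_diff X Z)" if "X \<subseteq> {..<?n}" for X
  proof -
    have "{i. i < ?n \<and> vert ?n X i = 1} = X"
      using that by (auto simp: vert_def)
    then show ?thesis by (simp add: \<phi>_def)
  qed
  have "strategy D \<delta> \<subseteq> (`) \<phi> ` strategy D \<gamma>"
  proof
    fix e assume "e \<in> strategy D \<delta>"
    then obtain X j where e: "e = edge ?n X j" "X \<subseteq> {..<?n}" "j < ?n" "fits D \<delta> X j"
      unfolding strategy_def by blast
    define W where "W = sym_diff X Z"
    have W: "W \<subseteq> {..<?n}" using e(2) Z(1) by (auto simp: W_def)
    have finX: "finite X" using e(2) by (rule finite_subset) simp
    have "fits D \<gamma> W j"
      unfolding fits_def
    proof (rule aligned_cong[THEN iffD1])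
      show "aligned D (\<lambda>t r. odd (cnt X t r) = (r \<in> \<delta> t)) j"
        using e(4) by (simp add: fits_def)
      show "(odd (cnt X t r) = (r \<in> \<delta> t)) = (odd (cnt W t r) = (r \<in> \<gamma> t))"
        if "t < D" "r < 3" for t r
        unfolding W_def odd_cnt_sym_diff[OF finX finZ] Z(2)[OF that] by blast
    qed
    then have "edge ?n W j \<in> strategy D \<gamma>"
      using W e(3) by (auto simp: strategy_def)
    moreover have "\<phi> ` edge ?n W j = e"
    proof -
      have "sym_diff W Z = X" "sym_diff (sym_diff W {j}) Z = sym_diff X {j}"
        unfolding W_def by blast+
      then show ?thesis
        by (simp only: edge_def e(1) image_insert image_empty \<phi>[OF W]
            \<phi>[OF sym_diff_flip_subset[OF W e(3)]])
    qed
    ultimately show "e \<in> (`) \<phi> ` strategy D \<gamma>" by blast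
  qed
  then show ?thesis
    using finite_strategy by (meson card_image_le card_mono finite_imageI order_trans)
qed

theorem theorem10:
  fixes d :: nat
  shows "\<exists>S :: (nat \<Rightarrow> nat) set set set.
           card S = 4 ^ (d + 1) \<and>
           (\<forall>M \<in> S. breaker_pairing_strategy (3 ^ (d + 1)) (3 ^ d + 1) M) \<and>
           pairwise disjnt S \<and>
           (\<exists>m. \<forall>M \<in> S. card M = m) \<and>
           \<Union> S = cube_edges (3 ^ (d + 1))"
proof (intro exI conjI)
  let ?D = "d + 1"
  let ?S = "strategy ?D ` labels ?D"
  \<comment> \<open>Disjoint strategies could coincide only if empty, so nonemptiness yields
    injectivity in the label.\<close>
  have nonempty: "strategy ?D \<gamma> \<noteq> {}" for \<gamma>
  proof -
    obtain j Y where "j \<in> {..<3 ^ ?D :: nat}" "Y \<subseteq> {..<3 ^ ?D}" "fits ?D \<gamma> Y j"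
      using exists_aligned[of "{..<3 ^ ?D}" ?D "\<lambda>t r. r \<in> \<gamma> t"] unfolding fits_def by auto
    then show ?thesis by (auto simp: strategy_def)
  qed
  have "inj_on (strategy ?D) (labels ?D)"
    using disjnt_strategies nonempty by (metis disjnt_self_iff_empty inj_onI)
  then show "card ?S = 4 ^ (d + 1)"
    by (simp only: card_image card_labels)
  \<comment> \<open>\<open>3 ^ d + 1\<close> is the least \<open>k\<close> with
    \<open>3 ^ (d + 1) < 3 * k\<close>.\<close>
  show "\<forall>M \<in> ?S. breaker_pairing_strategy (3 ^ (d + 1)) (3 ^ d + 1) M"
    using cube_matching_strategy[of ?D] strategy_covers_subcube[of _ ?D "3 ^ d + 1"]
    unfolding breaker_pairing_strategy_def by auto
  show "pairwise disjnt ?S"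
    using disjnt_strategies by (auto simp: pairwise_def)
  \<comment> \<open>Any label serves as reference, \<open>card_strategy_le\<close> being applied in
    both directions.\<close>
  show "\<forall>M \<in> ?S. card M = card (strategy ?D (SOME \<gamma>. \<gamma> \<in> labels ?D))"
    using card_strategy_le by (metis (mono_tags) antisym imageE someI)
  show "\<Union> ?S = cube_edges (3 ^ (d + 1))"
    by (rule Union_strategies)
qed

end
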